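(* For any reduced instance (with parameters $m$, $k$, $p$, $\varepsilon$) of the scheduling game $P\,||\sum w_jC_j$, there exists a feasible solution of (SDP-SR) with objective value equal to $$C(x^* )=\begin{cases}kp^2+\frac{m-k}{2}\alpha^2 & \text{if }p\ge\alpha,\\[2pt] \frac12\big(kp^2+m\beta^2\big)&\text{if }p\le\alpha,\end{cases}\qquad \alpha=\frac{m}{m-k},\quad \beta=\frac{m+pk}{m}.$$ This implies that the pure price of anarchy of the scheduling game $P\,||\sum w_jC_j$, where each machine schedules its jobs by increasing Smith ratio, is at most $\frac{1+\sqrt2}{2}$.
   Context: Game $P\,||\sum w_jC_j$: a finite set $J$ of jobs (players) with weights $w_j>0$ and processing times $p_j\ge 0$, and a finite set $M$ of identical machines, $m=|M|$. Each job chooses one machine; each machine processes its jobs in order of increasing Smith ratio $p_j/w_j$ (ties broken consistently by a fixed total order). $C_j(x)$ is the completion time of job $j$ in the assignment $x$, each job wants to minimize its own completion time, and the social cost is $C(x)=\sum_jw_jC_j(x)$. A pure Nash equilibrium is an assignment in which no job can strictly decrease its completion time by switching machine. The pure price of anarchy is the supremum over instances of the ratio between the social cost of a pure Nash equilibrium and the minimum social cost of an assignment. Reduced instance: $w_j=p_j$ for every job, and there are only two processing times $\varepsilon,p>0$ with $\varepsilon$ arbitrarily small. There are $m/\varepsilon$ small jobs (processing time $\varepsilon$; $m/\varepsilon$ an integer), of total workload $m$, and $k<m$ large jobs (processing time $p$). In a pure Nash equilibrium all small jobs are started and completed in $[0,1]$ and all large jobs start at time $1$. The displayed expression is the cost of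 an optimal solution $x^*$ of the reduced instance (with $\varepsilon$ arbitrarily small). The paper takes from the literature (Schwiegelshohn 2011) the fact that, to bound the pure price of anarchy, it suffices to consider reduced instances, together with this expression for the optimum and the fact that in both cases $C(x)/C(x^* )\le(1+\sqrt2)/2$ for the equilibrium $x$ of the reduced instance. (SDP-SR) for instances with $w_j=p_j$: the variables are reals $y_j$ $(j\in J)$ and vectors $v_0,v_{ij}\in\mathbb R^d$ $(j\in J,i\in M)$ for some $d\in\mathbb N$, with the standard inner product. Maximize $\sum_{j\in J}y_j-\frac12\|v_0\|^2$ subject to $y_j\le p_j^2-\frac12\|v_{ij}\|^2+\langle v_0,v_{ij}\rangle$ for all $j\in J,i\in M$; and $\langle v_{ij},v_{i'k}\rangle\le p_jp_k\mathbf 1_{\{i=i'\}}$ for all $(i,j)\ne(i',k)$ with $j,k\in J$, $i,i'\in M$. *)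

theory Defs
  imports
    Complex_Main
    "HOL-Library.FuncSet"
    "HOL-Library.Extended_Real"
    "Jordan_Normal_Form.Matrix"
begin

section \<open>The game and its pure equilibria\<close>

record ('j, 'm) sched_game =
  jobs :: "'j set"
  machines :: "'m set"
  weight :: "'j \<Rightarrow> real"
  ptime :: "'j \<Rightarrow> real"
  tie :: "('j \<times> 'j) set"

definition sched_instance :: "('j, 'm) sched_game \<Rightarrow> bool" where
  "sched_instance G \<longleftrightarrow>
     finite (jobs G) \<and> finite (machines G) \<and> machines G \<noteq> {} \<and>
     (\<forall>j\<in>jobs G. weight G j > 0 \<and> ptime G j \<ge> 0) \<and>
     linear_order_on (jobs G) (tie G)"

definition smith_ratio :: "('j, 'm) sched_game \<Rightarrow> 'j \<Rightarrow> real" where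
  "smith_ratio G j = ptime G j / weight G j"

definition precedes :: "('j, 'm) sched_game \<Rightarrow> 'j \<Rightarrow> 'j \<Rightarrow> bool" where
  "precedes G k j \<longleftrightarrow>
     smith_ratio G k < smith_ratio G j \<or>
     (smith_ratio G k = smith_ratio G j \<and> k \<noteq> j \<and> (k, j) \<in> tie G)"

text \<open>Assignments are extensional functions, so that there are only finitely many of them.\<close>

definition assignments :: "('j, 'm) sched_game \<Rightarrow> ('j \<Rightarrow> 'm) set" where
  "assignments G = jobs G \<rightarrow>\<^sub>E machines G"

definition completion :: "('j, 'm) sched_game \<Rightarrow> ('j \<Rightarrow> 'm) \<Rightarrow> 'j \<Rightarrow> real" where
  "completion G x j =
     (\<Sum>k\<in>{k \<in> jobs G. x k = x j \<and> (precedes G k j \<or> k = j)}. ptime G k)"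

definition social_cost :: "('j, 'm) sched_game \<Rightarrow> ('j \<Rightarrow> 'm) \<Rightarrow> real" where
  "social_cost G x = (\<Sum>j\<in>jobs G. weight G j * completion G x j)"

definition opt_cost :: "('j, 'm) sched_game \<Rightarrow> real" where
  "opt_cost G = Min (social_cost G ` assignments G)"

definition pure_nash :: "('j, 'm) sched_game \<Rightarrow> ('j \<Rightarrow> 'm) \<Rightarrow> bool" where
  "pure_nash G x \<longleftrightarrow>
     x \<in> assignments G \<and>
     (\<forall>j\<in>jobs G. \<forall>i\<in>machines G. completion G x j \<le> completion G (x(j := i)) j)"

text \<open>
  The supremum ranges over all instances whose jobs and machines are drawn from the two given
  types; with infinite types such as \<^typ>\<open>nat\<close> these are all instances up to renaming.
  The quotient is taken in \<^typ>\<open>ereal\<close>, where a positive number divided by 0 is \<open>\<infinity>\<close> and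
  0 divided by 0 is 0: an equilibrium of positive cost in an instance of optimal cost 0 would
  make the price of anarchy infinite.
\<close>

definition pure_poa :: "'j itself \<Rightarrow> 'm itself \<Rightarrow> ereal" where
  "pure_poa TJ TM =
     (SUP (G, x) \<in> {(G :: ('j, 'm) sched_game, x). sched_instance G \<and> pure_nash G x}.
        ereal (social_cost G x) / ereal (opt_cost G))"

section \<open>Reduced instances\<close>

definition reduced_instance :: "('j, 'm) sched_game \<Rightarrow> nat \<Rightarrow> nat \<Rightarrow> real \<Rightarrow> real \<Rightarrow> bool" where
  "reduced_instance G m k p \<epsilon> \<longleftrightarrow>
     sched_instance G \<and> card (machines G) = m \<and> k < m \<and> p > 0 \<and> \<epsilon> > 0 \<and>
     (\<forall>j\<in>jobs G. weight G j = ptime G j) \<and>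
     (\<exists>S L. jobs G = S \<union> L \<and> S \<inter> L = {} \<and>
        real (card S) = real m / \<epsilon> \<and> card L = k \<and>
        (\<forall>j\<in>S. ptime G j = \<epsilon>) \<and> (\<forall>j\<in>L. ptime G j = p))"

text \<open>
  The cost of an optimal assignment of a reduced instance in the limit of vanishing \<open>\<epsilon>\<close>.
  The two branches agree for \<open>p = \<alpha>\<close>.
\<close>

definition reduced_opt :: "nat \<Rightarrow> nat \<Rightarrow> real \<Rightarrow> real" where
  "reduced_opt m k p =
     (let \<alpha> = real m / (real m - real k);
          \<beta> = (real m + p * real k) / real m
      in if p \<ge> \<alpha> then real k * p\<^sup>2 + (real m - real k) / 2 * \<alpha>\<^sup>2
         else (real k * p\<^sup>2 + real m * \<beta>\<^sup>2) / 2)"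

section \<open>The semidefinite program\<close>

definition sdp_sr_feasible ::
  "('j, 'm) sched_game \<Rightarrow> nat \<Rightarrow> ('j \<Rightarrow> real) \<Rightarrow> real vec \<Rightarrow> ('m \<Rightarrow> 'j \<Rightarrow> real vec) \<Rightarrow> bool" where
  "sdp_sr_feasible G d y v0 v \<longleftrightarrow>
     v0 \<in> carrier_vec d \<and>
     (\<forall>i\<in>machines G. \<forall>j\<in>jobs G. v i j \<in> carrier_vec d) \<and>
     (\<forall>j\<in>jobs G. \<forall>i\<in>machines G.
        y j \<le> (ptime G j)\<^sup>2 - (v i j \<bullet> v i j) / 2 + v0 \<bullet> v i j) \<and>
     (\<forall>j\<in>jobs G. \<forall>k\<in>jobs G. \<forall>i\<in>machines G. \<forall>i'\<in>machines G.
        (i, j) \<noteq> (i', k) \<longrightarrow>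
        v i j \<bullet> v i' k \<le> ptime G j * ptime G k * (if i = i' then 1 else 0))"

definition sdp_sr_objective ::
  "('j, 'm) sched_game \<Rightarrow> ('j \<Rightarrow> real) \<Rightarrow> real vec \<Rightarrow> real" where
  "sdp_sr_objective G y v0 = (\<Sum>j\<in>jobs G. y j) - (v0 \<bullet> v0) / 2"

end

theory Submission
  imports Defs
begin

text \<open>
  For \<open>\<mu> \<ge> 0\<close> the vectors \<open>v\<^sub>i\<^sub>j = min p\<^sub>j \<mu> \<cdot> e\<^sub>i\<close> and \<open>v\<^sub>0 = \<mu> \<cdot> \<Sum>\<^sub>i e\<^sub>i\<close> are feasible for (SDP-SR); weak
  duality bounds the cost of every assignment from below by \<open>(\<Sum>\<^sub>j g(p\<^sub>j) - m \<mu>\<^sup>2) / 2\<close>, where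
  \<open>g(p)/2 = p\<^sup>2 - q\<^sup>2/2 + \<mu> q\<close> and \<open>q = min p \<mu>\<close>. For reduced instances one takes \<open>\<mu> = \<alpha>\<close> or
  \<open>\<mu> = \<beta>\<close>, and filling the machines greedily up to level \<open>\<mu>\<close> shows that the bound is tight.

  For the price of anarchy no reduction to reduced instances is needed. Summation by parts
  over the levels of \<open>w/p\<close> gives \<open>w = p\<close>. In an equilibrium every job then starts no later than
  the minimum load \<open>T\<close>, and with \<open>\<mu> = \<surd>2 T\<close> the bound \<open>(1 + \<surd>2)/2\<close> between the cost and the
  dual value holds machine by machine.
\<close>

section \<open>Dual bound for the sum of squares\<close>

text \<open>The function \<open>g\<close> of the overview. For nonnegative \<mu> and
  \<open>p\<close> it is the maximum over 0 \<le> \<open>q\<close> \<le> \<open>p\<close> of the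
  concave function \<open>2 * p\<^sup>2 - q\<^sup>2 + 2 * \<mu> * q\<close>, whose unconstrained
  peak is at \<open>q\<close> = \<mu>; hence the truncation.\<close>

definition dual_value :: "real \<Rightarrow> real \<Rightarrow> real" where
  "dual_value \<mu> p = 2 * p\<^sup>2 - (min p \<mu>)\<^sup>2 + 2 * \<mu> * min p \<mu>"

lemma dual_value_le: "p \<le> \<mu> \<Longrightarrow> dual_value \<mu> p = p\<^sup>2 + 2 * \<mu> * p"
  by (simp add: dual_value_def min_def)

lemma dual_value_ge: "\<mu> \<le> p \<Longrightarrow> dual_value \<mu> p = 2 * p\<^sup>2 + \<mu>\<^sup>2"
  by (auto simp: dual_value_def min_def power2_eq_square)

lemma dual_value_ge_linear: "dual_value \<mu> p \<ge> p\<^sup>2 + 2 * \<mu> * p"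
proof (cases "p \<le> \<mu>")
  case False
  have "0 \<le> (p - \<mu>)\<^sup>2" by simp
  with False show ?thesis by (simp add: dual_value_ge power2_diff algebra_simps)
qed (simp add: dual_value_le)

lemma dual_value_ge_linear': "2 * \<mu> * p \<le> dual_value \<mu> p"
  using dual_value_ge_linear[of p \<mu>] zero_le_power2[of p] by linarith

text \<open>The difference is the sum of the products over all ordered pairs of distinct indices, so
  it grows with each nonnegative entry.\<close>

lemma square_sum_minus_sum_squares_mono:
  fixes p q :: "'a \<Rightarrow> real"
  assumes "finite A" and "\<And>j. j \<in> A \<Longrightarrow> 0 \<le> q j \<and> q j \<le> p j"
  shows "(sum q A)\<^sup>2 - (\<Sum>j\<in>A. (q j)\<^sup>2) \<le> (sum p A)\<^sup>2 - (\<Sum>j\<in>A. (p j)\<^sup>2)"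
  using assms
proof (induction A rule: finite_induct)
  case (insert a A)
  have "q a * sum q A \<le> p a * sum p A"
    using insert.prems by (intro mult_mono sum_mono sum_nonneg) (auto intro: order_trans)
  with insert show ?case by (simp add: power2_sum)
qed simp

text \<open>Weak duality on one machine. Monotonicity of the pair products replaces \<open>p\<close>
  by the truncated \<open>q\<close>, and what remains is the square of
  \<open>sum q A - \<mu>\<close>.\<close>

lemma sum_dual_value_le:
  fixes p :: "'a \<Rightarrow> real"
  assumes "finite A" and "\<And>j. j \<in> A \<Longrightarrow> 0 \<le> p j" and "0 \<le> \<mu>"
  shows "(\<Sum>j\<in>A. dual_value \<mu> (p j)) - \<mu>\<^sup>2 \<le> (sum p A)\<^sup>2 + (\<Sum>j\<in>A. (p j)\<^sup>2)"
proof -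
  define q where "q j = min (p j) \<mu>" for j
  have "(sum q A)\<^sup>2 - (\<Sum>j\<in>A. (q j)\<^sup>2) \<le> (sum p A)\<^sup>2 - (\<Sum>j\<in>A. (p j)\<^sup>2)"
    using assms by (intro square_sum_minus_sum_squares_mono) (auto simp: q_def)
  moreover have "0 \<le> (sum q A - \<mu>)\<^sup>2" by simp
  moreover have "(\<Sum>j\<in>A. dual_value \<mu> (p j))
      = 2 * (\<Sum>j\<in>A. (p j)\<^sup>2) - (\<Sum>j\<in>A. (q j)\<^sup>2) + 2 * \<mu> * sum q A"
    by (simp add: dual_value_def q_def sum.distrib sum_subtractf sum_distrib_left)
  ultimately show ?thesis by (simp add: power2_diff algebra_simps)
qed

section \<open>Reverse comparison with the dual value on one machine\<close>

abbreviation (input) poa_bound :: real where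
  "poa_bound \<equiv> (1 + sqrt 2) / 2"

lemma poa_bound_ge_1: "1 \<le> poa_bound"
  by simp

text \<open>Here \<open>s\<close> is the start time and \<open>q\<close> the length of the last job
  of a machine, and \<open>T\<close> is the minimum load. The earlier jobs enter only through the
  linear part \<open>2 * \<mu> * s\<close> of their dual values.\<close>

lemma last_job_dual_bound:
  fixes s q T :: real
  assumes "0 \<le> s" "s \<le> T" "0 \<le> q" "T \<le> s + q"
  defines "\<mu> \<equiv> sqrt 2 * T"
  shows "(s + q)\<^sup>2 + q\<^sup>2 \<le> poa_bound * (2 * \<mu> * s + dual_value \<mu> q - \<mu>\<^sup>2)"
proof -
  define r where "r = sqrt (2::real)"
  have r: "r * r = 2" "1 \<le> r" by (auto simp: r_def)
  have mu: "\<mu> = r * T" by (simp add: \<mu>_def r_def)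
  have mu2: "\<mu>\<^sup>2 = 2 * T\<^sup>2" using r by (simp add: mu power2_eq_square algebra_simps)
  have cmu: "poa_bound * (2 * \<mu> * z) = (r + 2) * T * z" for z
  proof -
    have "poa_bound * (2 * \<mu> * z) = (r + r * r) * T * z"
      by (simp add: mu r_def[symmetric] field_simps)
    then show ?thesis by (simp add: r)
  qed
  show ?thesis
  proof (cases "\<mu> \<le> q")
    case True
    \<comment> \<open>The weights are dictated by the budget: \<open>(1 + r) * q\<^sup>2\<close>
      leaves \<open>(r - 1) * q\<^sup>2\<close> after \<open>2 * q\<^sup>2\<close> is paid, and
      \<open>(r + 1) * (r - 1) = 1\<close> makes the mixed term exactly
      \<open>2 * s * q\<close>.\<close>
    have "0 \<le> (r + 1) * (s - (r - 1) * q)\<^sup>2" using r by simp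
    also have "\<dots> = (r + 1) * s\<^sup>2 - 2 * ((r + 1) * (r - 1)) * s * q + ((r + 1) * (r - 1)) * (r - 1) * q\<^sup>2"
      by (simp add: power2_eq_square algebra_simps)
    also have "(r + 1) * (r - 1) = 1" using r by (simp add: algebra_simps)
    finally have 1: "2 * s * q \<le> (r + 1) * s\<^sup>2 + (r - 1) * q\<^sup>2" by simp
    have "s * s \<le> T * s" using assms by (intro mult_right_mono) auto
    then have 2: "(r + 2) * s\<^sup>2 \<le> (r + 2) * T * s"
      using r by (simp add: power2_eq_square mult.assoc)
    have "poa_bound * (2 * \<mu> * s + dual_value \<mu> q - \<mu>\<^sup>2)
        = poa_bound * (2 * \<mu> * s) + poa_bound * (2 * q\<^sup>2)"
      using True by (simp add: dual_value_ge algebra_simps)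
    also have "\<dots> = (r + 2) * T * s + (1 + r) * q\<^sup>2"
      unfolding cmu by (simp add: r_def)
    finally show ?thesis using 1 2 by (simp add: power2_eq_square algebra_simps)
  next
    case False
    have "s + q \<le> T + r * T" using False assms(2) mu by simp
    \<comment> \<open>The final load lies between \<open>T\<close> and \<open>(1 + r) * T\<close>.
      The sum and product of these endpoints are the coefficients that \<mu> = \<open>r * T\<close>
      yields after multiplication by \<open>poa_bound\<close>, which explains the choice of
      \<mu>.\<close>
    then have "(s + q - T) * (s + q - (1 + r) * T) \<le> 0"
      using assms(4) by (intro mult_nonneg_nonpos) (auto simp: algebra_simps)
    then have 1: "(s + q)\<^sup>2 \<le> (r + 2) * T * (s + q) - (1 + r) * T\<^sup>2"
      by (simp add: power2_eq_square algebra_simps)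
    have 2: "q\<^sup>2 \<le> poa_bound * q\<^sup>2"
      using mult_right_mono[OF poa_bound_ge_1, of "q\<^sup>2"] by simp
    have "poa_bound * (2 * \<mu> * s + dual_value \<mu> q - \<mu>\<^sup>2)
        = poa_bound * (2 * \<mu> * (s + q)) + poa_bound * q\<^sup>2 - poa_bound * \<mu>\<^sup>2"
      using False by (simp add: dual_value_le algebra_simps)
    also have "\<dots> = (r + 2) * T * (s + q) + poa_bound * q\<^sup>2 - (1 + r) * T\<^sup>2"
      unfolding cmu mu2 by (simp add: r_def)
    finally show ?thesis using 1 2 by linarith
  qed
qed

text \<open>The job \<open>l\<close> bears the whole loss of \<open>\<mu>\<^sup>2\<close>. For each
  other job the excess of the dual value over its linear part already covers the square of its
  length.\<close>

lemma machine_dual_bound: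
  fixes p :: "'a \<Rightarrow> real" and T :: real
  assumes fin: "finite A" and nonneg: "\<And>j. j \<in> A \<Longrightarrow> 0 \<le> p j"
    and T: "0 \<le> T" "T \<le> sum p A"
    and last: "A \<noteq> {} \<Longrightarrow> \<exists>l\<in>A. sum p (A - {l}) \<le> T"
  defines "\<mu> \<equiv> sqrt 2 * T"
  shows "(sum p A)\<^sup>2 + (\<Sum>j\<in>A. (p j)\<^sup>2) \<le> poa_bound * ((\<Sum>j\<in>A. dual_value \<mu> (p j)) - \<mu>\<^sup>2)"
proof (cases "A = {}")
  \<comment> \<open>An empty machine forces \<open>T\<close> = 0 and hence \<mu> = 0.\<close>
  case True
  with T show ?thesis by (simp add: \<mu>_def)
next
  case False
  with last obtain l where l: "l \<in> A" "sum p (A - {l}) \<le> T" by blast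
  define B where "B = A - {l}"
  have A: "A = insert l B" "finite B" "l \<notin> B" using l fin by (auto simp: B_def)
  have "(p j)\<^sup>2 \<le> poa_bound * (dual_value \<mu> (p j) - 2 * \<mu> * p j)" for j
  proof -
    have "(p j)\<^sup>2 \<le> dual_value \<mu> (p j) - 2 * \<mu> * p j"
      using dual_value_ge_linear[of "p j" \<mu>] by linarith
    also from this have "\<dots> \<le> poa_bound * \<dots>"
      using mult_right_mono[OF poa_bound_ge_1] zero_le_power2[of "p j"]
      by (metis mult_1 order_trans)
    finally show ?thesis .
  qed
  then have "(\<Sum>j\<in>B. (p j)\<^sup>2) \<le> (\<Sum>j\<in>B. poa_bound * (dual_value \<mu> (p j) - 2 * \<mu> * p j))"
    by (intro sum_mono)
  also have "\<dots> = poa_bound * ((\<Sum>j\<in>B. dual_value \<mu> (p j)) - 2 * \<mu> * sum p B)"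
    by (simp only: sum_distrib_left[symmetric] sum_subtractf)
  finally have B: "(\<Sum>j\<in>B. (p j)\<^sup>2) \<le> poa_bound * ((\<Sum>j\<in>B. dual_value \<mu> (p j)) - 2 * \<mu> * sum p B)" .
  have "(sum p B + p l)\<^sup>2 + (p l)\<^sup>2
      \<le> poa_bound * (2 * \<mu> * sum p B + dual_value \<mu> (p l) - \<mu>\<^sup>2)"
    unfolding \<mu>_def using l nonneg T A
    by (intro last_job_dual_bound) (auto simp: B_def[symmetric] add.commute intro!: sum_nonneg)
  with B have "(sum p B + p l)\<^sup>2 + (p l)\<^sup>2 + (\<Sum>j\<in>B. (p j)\<^sup>2)
      \<le> poa_bound * (2 * \<mu> * sum p B + dual_value \<mu> (p l) - \<mu>\<^sup>2)
        + poa_bound * ((\<Sum>j\<in>B. dual_value \<mu> (p j)) - 2 * \<mu> * sum p B)"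
    by linarith
  also have "\<dots> = poa_bound * (dual_value \<mu> (p l) + (\<Sum>j\<in>B. dual_value \<mu> (p j)) - \<mu>\<^sup>2)"
    by (simp only: distrib_left[symmetric]) (simp add: algebra_simps)
  finally show ?thesis using A by (simp add: add.commute add.left_commute)
qed

section \<open>Costs of assignments\<close>

text \<open>The job set is a parameter because loads restricted to initial segments are
  needed.\<close>

definition load :: "('j \<Rightarrow> real) \<Rightarrow> 'j set \<Rightarrow> ('j \<Rightarrow> 'm) \<Rightarrow> 'm \<Rightarrow> real" where
  "load p K x i = sum p {j \<in> K. x j = i}"

lemma sum_over_machines:
  assumes "finite K" "finite M" "x ` K \<subseteq> M"
  shows "(\<Sum>i\<in>M. \<Sum>j\<in>{j \<in> K. x j = i}. h j) = sum h K"
  using sum.group[OF assms, of h] by simp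

text \<open>Of two distinct jobs on a machine exactly one delays the other. Adding the double sum to
  its transpose therefore counts every ordered pair on a common machine once and the diagonal once
  more. In particular the value does not depend on the order.\<close>

lemma sum_completion_eq_sum_squares:
  fixes p :: "'j \<Rightarrow> real"
  assumes fin: "finite K" "finite M" and x: "x ` K \<subseteq> M"
    and tot: "\<And>j k. j \<in> K \<Longrightarrow> k \<in> K \<Longrightarrow> j \<noteq> k \<Longrightarrow> prec j k \<longleftrightarrow> \<not> prec k j"
    and irr: "\<And>j. \<not> prec j j"
  shows "(\<Sum>j\<in>K. p j * sum p {k \<in> K. x k = x j \<and> (prec k j \<or> k = j)})
    = ((\<Sum>i\<in>M. (load p K x i)\<^sup>2) + (\<Sum>j\<in>K. (p j)\<^sup>2)) / 2"
proof -
  define P where "P j k = (if x k = x j then p j * p k else 0)" for j k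
  define Q where "Q j k = (if prec k j \<or> k = j then P j k else 0)" for j k
  have "(\<Sum>j\<in>K. p j * sum p {k \<in> K. x k = x j \<and> (prec k j \<or> k = j)}) = (\<Sum>j\<in>K. \<Sum>k\<in>K. Q j k)"
  proof (intro sum.cong refl)
    fix j
    have "sum p {k \<in> K. x k = x j \<and> (prec k j \<or> k = j)}
        = (\<Sum>k\<in>K. if x k = x j \<and> (prec k j \<or> k = j) then p k else 0)"
      using fin by (simp add: sum.inter_filter)
    also have "p j * \<dots> = (\<Sum>k\<in>K. Q j k)"
      unfolding sum_distrib_left by (intro sum.cong) (auto simp: Q_def P_def)
    finally show "p j * sum p {k \<in> K. x k = x j \<and> (prec k j \<or> k = j)} = (\<Sum>k\<in>K. Q j k)" .
  qed
  moreover have "(\<Sum>j\<in>K. \<Sum>k\<in>K. Q j k) + (\<Sum>j\<in>K. \<Sum>k\<in>K. Q k j)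
      = (\<Sum>j\<in>K. \<Sum>k\<in>K. P j k) + (\<Sum>j\<in>K. (p j)\<^sup>2)"
  proof -
    have "(\<Sum>j\<in>K. \<Sum>k\<in>K. Q j k) + (\<Sum>j\<in>K. \<Sum>k\<in>K. Q k j)
        = (\<Sum>j\<in>K. \<Sum>k\<in>K. P j k + (if j = k then (p j)\<^sup>2 else 0))"
      unfolding sum.distrib[symmetric]
    proof (intro sum.cong refl)
      fix j k assume "j \<in> K" "k \<in> K"
      then show "Q j k + Q k j = P j k + (if j = k then (p j)\<^sup>2 else 0)"
        using tot[of j k] irr[of j] by (auto simp: Q_def P_def power2_eq_square)
    qed
    also have "\<dots> = (\<Sum>j\<in>K. \<Sum>k\<in>K. P j k) + (\<Sum>j\<in>K. (p j)\<^sup>2)"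
      using fin by (simp add: sum.distrib)
    finally show ?thesis .
  qed
  moreover have "(\<Sum>j\<in>K. \<Sum>k\<in>K. Q k j) = (\<Sum>j\<in>K. \<Sum>k\<in>K. Q j k)"
    by (rule sum.swap)
  moreover have "(\<Sum>j\<in>K. \<Sum>k\<in>K. P j k) = (\<Sum>i\<in>M. (load p K x i)\<^sup>2)"
  proof -
    have "(\<Sum>j\<in>K. \<Sum>k\<in>K. P j k) = (\<Sum>j\<in>K. p j * load p K x (x j))"
    proof (intro sum.cong refl)
      fix j
      have "load p K x (x j) = (\<Sum>k\<in>K. if x k = x j then p k else 0)"
        using fin by (simp add: load_def sum.inter_filter)
      then show "(\<Sum>k\<in>K. P j k) = p j * load p K x (x j)"
        by (auto simp: sum_distrib_left P_def intro!: sum.cong)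
    qed
    also have "\<dots> = (\<Sum>i\<in>M. \<Sum>j\<in>{j \<in> K. x j = i}. p j * load p K x (x j))"
      by (rule sum_over_machines[OF fin x, symmetric])
    also have "\<dots> = (\<Sum>i\<in>M. (load p K x i)\<^sup>2)"
    proof (intro sum.cong refl)
      fix i
      have "(\<Sum>j\<in>{j \<in> K. x j = i}. p j * load p K x (x j))
          = (\<Sum>j\<in>{j \<in> K. x j = i}. p j * load p K x i)"
        by (intro sum.cong) auto
      then show "(\<Sum>j\<in>{j \<in> K. x j = i}. p j * load p K x (x j)) = (load p K x i)\<^sup>2"
        by (simp add: sum_distrib_right[symmetric] power2_eq_square load_def)
    qed
    finally show ?thesis .
  qed
  ultimately show ?thesis by simp
qed

text \<open>The left-hand side does not mention \<open>x\<close>: one dual value bounds all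
  assignments at once.\<close>

lemma sum_squares_ge_dual:
  fixes p :: "'j \<Rightarrow> real"
  assumes fin: "finite K" "finite M" and x: "x ` K \<subseteq> M"
    and "\<And>j. j \<in> K \<Longrightarrow> 0 \<le> p j" "0 \<le> \<mu>"
  shows "(\<Sum>j\<in>K. dual_value \<mu> (p j)) - real (card M) * \<mu>\<^sup>2
    \<le> (\<Sum>i\<in>M. (load p K x i)\<^sup>2) + (\<Sum>j\<in>K. (p j)\<^sup>2)"
proof -
  have "(\<Sum>i\<in>M. (\<Sum>j\<in>{j \<in> K. x j = i}. dual_value \<mu> (p j)) - \<mu>\<^sup>2)
      \<le> (\<Sum>i\<in>M. (load p K x i)\<^sup>2 + (\<Sum>j\<in>{j \<in> K. x j = i}. (p j)\<^sup>2))"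
    unfolding load_def using assms by (intro sum_mono sum_dual_value_le) auto
  then show ?thesis
    by (simp add: sum_subtractf sum.distrib sum_over_machines[OF fin x])
qed

section \<open>Precedence order and initial segments\<close>

lemma precedes_irrefl: "\<not> precedes G j j"
  by (simp add: precedes_def)

lemma precedes_total:
  assumes "sched_instance G" "j \<in> jobs G" "k \<in> jobs G" "j \<noteq> k"
  shows "precedes G j k \<longleftrightarrow> \<not> precedes G k j"
proof -
  have "total_on (jobs G) (tie G)" "antisym (tie G)"
    using assms by (auto simp: sched_instance_def linear_order_on_def partial_order_on_def)
  then have "(j, k) \<in> tie G \<longleftrightarrow> (k, j) \<notin> tie G"
    using assms unfolding total_on_def antisym_def by blast
  with assms(4) show ?thesis by (auto simp: precedes_def)
qed

lemma precedes_trans: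
  assumes "sched_instance G" "precedes G j k" "precedes G k l"
  shows "precedes G j l"
proof -
  have "trans (tie G)" "antisym (tie G)"
    using assms(1)
    by (auto simp: sched_instance_def linear_order_on_def partial_order_on_def preorder_on_def)
  then show ?thesis
    using assms(2,3) unfolding precedes_def trans_def antisym_def by (smt (verit))
qed

text \<open>Jobs of length 0 may be left out of an initial segment, so that \<open>w/p\<close> makes sense on it.\<close>

definition initial_segment :: "('j, 'm) sched_game \<Rightarrow> 'j set \<Rightarrow> bool" where
  "initial_segment G K \<longleftrightarrow> K \<subseteq> jobs G \<and>
     (\<forall>j\<in>K. \<forall>k\<in>jobs G. precedes G k j \<longrightarrow> k \<in> K \<or> ptime G k = 0)"

lemma initial_segment_jobs: "initial_segment G (jobs G)"
  by (simp add: initial_segment_def)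

text \<open>Predecessors outside \<open>K\<close> have length 0, so the game can be studied on
  \<open>K\<close> alone.\<close>

lemma completion_initial_segment:
  assumes "sched_instance G" "initial_segment G K" "j \<in> K"
  shows "completion G x j = sum (ptime G) {k \<in> K. x k = x j \<and> (precedes G k j \<or> k = j)}"
  unfolding completion_def
  using assms
  by (intro sum.mono_neutral_right) (auto simp: initial_segment_def sched_instance_def)

lemma sum_ptime_completion:
  assumes G: "sched_instance G" "initial_segment G K" and x: "x \<in> assignments G"
  shows "(\<Sum>j\<in>K. ptime G j * completion G x j)
    = ((\<Sum>i\<in>machines G. (load (ptime G) K x i)\<^sup>2) + (\<Sum>j\<in>K. (ptime G j)\<^sup>2)) / 2"
proof -
  have K: "K \<subseteq> jobs G" "finite K" "finite (machines G)"
    using G by (auto simp: initial_segment_def sched_instance_def intro: finite_subset)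
  have "(\<Sum>j\<in>K. ptime G j * completion G x j)
      = (\<Sum>j\<in>K. ptime G j * sum (ptime G) {k \<in> K. x k = x j \<and> (precedes G k j \<or> k = j)})"
    using completion_initial_segment[OF G] by (intro sum.cong) auto
  also have "\<dots> = ((\<Sum>i\<in>machines G. (load (ptime G) K x i)\<^sup>2) + (\<Sum>j\<in>K. (ptime G j)\<^sup>2)) / 2"
    using K x precedes_total[OF G(1)] precedes_irrefl[of G]
    by (intro sum_completion_eq_sum_squares) (auto simp: assignments_def, blast+)
  finally show ?thesis .
qed

section \<open>The price of anarchy\<close>

text \<open>After moving to \<open>i\<close>, job \<open>j\<close> would wait only for its
  predecessors there, whose total length is at most the load of \<open>i\<close>. At equilibrium
  this cannot beat its present start time.\<close>

lemma pure_nash_start_le_load: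
  assumes G: "sched_instance G" "initial_segment G K" and x: "pure_nash G x"
    and j: "j \<in> K" and i: "i \<in> machines G"
  shows "sum (ptime G) {k \<in> K. x k = x j \<and> precedes G k j} \<le> load (ptime G) K x i"
proof -
  let ?p = "ptime G"
  have K: "K \<subseteq> jobs G" "finite K"
    using G by (auto simp: initial_segment_def sched_instance_def intro: finite_subset)
  have compl: "completion G z j = ?p j + sum ?p {k \<in> K. z k = z j \<and> precedes G k j}" for z
  proof -
    have "{k \<in> K. z k = z j \<and> (precedes G k j \<or> k = j)}
        = insert j {k \<in> K. z k = z j \<and> precedes G k j}"
      using j by auto
    then show ?thesis
      using completion_initial_segment[OF G j, of z] K by (simp add: precedes_irrefl)
  qed
  have "completion G x j \<le> completion G (x(j := i)) j"
    using x j i K by (auto simp: pure_nash_def)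
  then have "sum ?p {k \<in> K. x k = x j \<and> precedes G k j}
      \<le> sum ?p {k \<in> K. (x(j := i)) k = i \<and> precedes G k j}"
    unfolding compl by simp
  also have "\<dots> \<le> load ?p K x i"
    unfolding load_def using K G
    by (intro sum_mono2) (auto simp: precedes_irrefl sched_instance_def split: if_splits)
  finally show ?thesis .
qed

text \<open>The jobs of \<open>K\<close> are charged their lengths instead of their weights; the
  equilibrium condition survives because it concerns completion times only.\<close>

lemma pure_nash_unit_density_bound:
  assumes G: "sched_instance G" "initial_segment G K" and x: "pure_nash G x"
    and y: "y \<in> assignments G"
  shows "(\<Sum>j\<in>K. ptime G j * completion G x j)
    \<le> poa_bound * (\<Sum>j\<in>K. ptime G j * completion G y j)"
proof -
  let ?p = "ptime G" and ?M = "machines G"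
  have K: "K \<subseteq> jobs G" "finite K" and M: "finite ?M" "?M \<noteq> {}"
    using G by (auto simp: initial_segment_def sched_instance_def intro: finite_subset)
  have nonneg: "0 \<le> ?p j" if "j \<in> K" for j
    using that K G by (auto simp: sched_instance_def)
  have xa: "x \<in> assignments G" using x by (simp add: pure_nash_def)
  have im: "x ` K \<subseteq> ?M" "y ` K \<subseteq> ?M" using xa y K by (auto simp: assignments_def)
  define T where "T = Min (load ?p K x ` ?M)"
  define \<mu> where "\<mu> = sqrt 2 * T"
  have T_le: "T \<le> load ?p K x i" if "i \<in> ?M" for i
    unfolding T_def using that M by simp
  have "T \<in> load ?p K x ` ?M" unfolding T_def using M by (intro Min_in) auto
  then obtain i0 where i0: "i0 \<in> ?M" "T = load ?p K x i0" by blast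
  have T0: "0 \<le> T" unfolding i0 load_def using nonneg by (intro sum_nonneg) auto
  have machine: "(load ?p K x i)\<^sup>2 + (\<Sum>j\<in>{j \<in> K. x j = i}. (?p j)\<^sup>2)
      \<le> poa_bound * ((\<Sum>j\<in>{j \<in> K. x j = i}. dual_value \<mu> (?p j)) - \<mu>\<^sup>2)"
    if i: "i \<in> ?M" for i
    unfolding load_def \<mu>_def
  proof (rule machine_dual_bound)
    let ?A = "{j \<in> K. x j = i}"
    show "T \<le> sum ?p ?A" using T_le[OF i] by (simp add: load_def)
    assume "?A \<noteq> {}"
    moreover have "asymp_on ?A (precedes G)" "transp_on ?A (precedes G)"
      using precedes_trans[OF G(1)] precedes_irrefl[of G]
      by (auto simp: asymp_on_def transp_on_def)
    \<comment> \<open>All other jobs of the machine precede its last job \<open>l\<close>, so their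
      total length is the start time of \<open>l\<close>, which is at most the minimum load.\<close>
    ultimately obtain l where l: "l \<in> ?A" "\<And>k. k \<in> ?A \<Longrightarrow> k \<noteq> l \<Longrightarrow> \<not> precedes G l k"
      using Finite_Set.bex_max_element[of ?A "precedes G"] K(2) by auto
    have "?A - {l} = {k \<in> K. x k = x l \<and> precedes G k l}"
      using l K precedes_total[OF G(1)] precedes_irrefl[of G] by (auto; blast)
    then have "sum ?p (?A - {l}) \<le> T"
      using pure_nash_start_le_load[OF G x, of l i0] i0 l by simp
    with l show "\<exists>l\<in>?A. sum ?p (?A - {l}) \<le> T" by blast
  qed (use K nonneg T0 in auto)
  have "2 * (\<Sum>j\<in>K. ?p j * completion G x j)
      = (\<Sum>i\<in>?M. (load ?p K x i)\<^sup>2 + (\<Sum>j\<in>{j \<in> K. x j = i}. (?p j)\<^sup>2))"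
    by (simp add: sum_ptime_completion[OF G xa] sum.distrib sum_over_machines[OF K(2) M(1) im(1)])
  also have "\<dots> \<le> (\<Sum>i\<in>?M. poa_bound * ((\<Sum>j\<in>{j \<in> K. x j = i}. dual_value \<mu> (?p j)) - \<mu>\<^sup>2))"
    by (intro sum_mono machine)
  also have "\<dots> = poa_bound * ((\<Sum>j\<in>K. dual_value \<mu> (?p j)) - real (card ?M) * \<mu>\<^sup>2)"
    unfolding sum_distrib_left[symmetric]
    by (simp add: sum_subtractf sum_over_machines[OF K(2) M(1) im(1)])
  \<comment> \<open>The dual value depends on the lengths alone, so it passes from \<open>x\<close>
    to \<open>y\<close>.\<close>
  also have "\<dots> \<le> poa_bound * ((\<Sum>i\<in>?M. (load ?p K y i)\<^sup>2) + (\<Sum>j\<in>K. (?p j)\<^sup>2))"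
    using K M im nonneg T0 by (intro mult_left_mono sum_squares_ge_dual) (auto simp: \<mu>_def)
  also have "\<dots> = 2 * (poa_bound * (\<Sum>j\<in>K. ?p j * completion G y j))"
    by (simp add: sum_ptime_completion[OF G y])
  finally show ?thesis by linarith
qed

section \<open>From unit density to arbitrary weights\<close>

text \<open>Summation by parts over the values of \<open>r\<close>: subtracting the minimum
  \<open>t\<close> splits off \<open>t * sum a J\<close> and annihilates the terms where it is
  attained, leaving a smaller index set.\<close>

lemma weighted_sum_nonpos_if_upper_level_sums_nonpos:
  fixes a r :: "'a \<Rightarrow> real"
  assumes "finite J" and "\<And>j. j \<in> J \<Longrightarrow> 0 \<le> r j"
    and "\<And>t. sum a {j \<in> J. t \<le> r j} \<le> 0"
  shows "(\<Sum>j\<in>J. r j * a j) \<le> 0"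
  using assms
proof (induction "card J" arbitrary: J r rule: less_induct)
  case less
  show ?case
  proof (cases "J = {}")
    case False
    define t where "t = Min (r ` J)"
    define J' where "J' = {j \<in> J. t < r j}"
    have t: "t \<le> r j" if "j \<in> J" for j
      unfolding t_def using that less.prems(1) by simp
    have "t \<in> r ` J" unfolding t_def using False less.prems(1) by (intro Min_in) auto
    then obtain j0 where j0: "j0 \<in> J" "r j0 = t" by auto
    have "(\<Sum>j\<in>J'. (r j - t) * a j) \<le> 0"
    proof (rule less.hyps)
      show "card J' < card J"
        using j0 less.prems(1) by (intro psubset_card_mono) (auto simp: J'_def)
      fix u
      show "sum a {j \<in> J'. u \<le> r j - t} \<le> 0"
      proof (cases "u > 0")
        case True
        then have "{j \<in> J'. u \<le> r j - t} = {j \<in> J. u + t \<le> r j}" by (auto simp: J'_def)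
        then show ?thesis using less.prems(3)[of "u + t"] by simp
      next
        case False
        then have eq: "{j \<in> J'. u \<le> r j - t} = J'" by (auto simp: J'_def)
        show ?thesis
        proof (cases "J' = {}")
          case nonempty: False
          \<comment> \<open>For \<open>u\<close> \<le> 0 the level set is all of \<open>J'\<close>,
            defined by a strict inequality. By finiteness it is also the closed level set of the
            original \<open>r\<close> at the least value \<open>v\<close> on
            \<open>J'\<close>.\<close>
          define v where "v = Min (r ` J')"
          have "finite J'" using less.prems(1) by (simp add: J'_def)
          then have "v \<in> r ` J'" and le: "\<And>j. j \<in> J' \<Longrightarrow> v \<le> r j"
            unfolding v_def using nonempty by (auto intro: Min_in)
          then have "t < v" by (auto simp: J'_def)
          with le have "J' = {j \<in> J. v \<le> r j}" by (auto simp: J'_def)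
          then show ?thesis using eq less.prems(3)[of v] by simp
        qed (use eq in simp)
      qed
    qed (use less.prems in \<open>auto simp: J'_def\<close>)
    also have "(\<Sum>j\<in>J'. (r j - t) * a j) = (\<Sum>j\<in>J. (r j - t) * a j)"
      using less.prems(1) t by (intro sum.mono_neutral_left) (force simp: J'_def)+
    finally have "(\<Sum>j\<in>J. r j * a j) \<le> t * sum a J"
      by (simp add: left_diff_distrib sum_subtractf sum_distrib_left)
    moreover have "{j \<in> J. t \<le> r j} = J" using t by auto
    then have "sum a J \<le> 0" using less.prems(3)[of t] by simp
    then have "t * sum a J \<le> 0" using less.prems(2)[OF j0(1)] j0 by (simp add: mult_nonneg_nonpos)
    ultimately show ?thesis by linarith
  qed simp
qed

text \<open>High density is low Smith ratio, so predecessors of positive length are at least as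
  dense. Positivity of \<open>ptime\<close> keeps division by 0 out.\<close>

lemma initial_segment_density_level:
  assumes "sched_instance G"
  shows "initial_segment G {j \<in> jobs G. 0 < ptime G j \<and> t \<le> weight G j / ptime G j}"
  unfolding initial_segment_def
proof (intro conjI ballI impI)
  fix j k
  assume j: "j \<in> {j \<in> jobs G. 0 < ptime G j \<and> t \<le> weight G j / ptime G j}"
    and k: "k \<in> jobs G" and "precedes G k j"
  then have "ptime G k / weight G k \<le> ptime G j / weight G j"
    by (auto simp: precedes_def smith_ratio_def)
  moreover have w: "0 < weight G j" "0 < weight G k" "0 \<le> ptime G k"
    using assms j k by (auto simp: sched_instance_def)
  ultimately have "weight G j / ptime G j \<le> weight G k / ptime G k" if "0 < ptime G k"
    using that j by (simp add: field_simps)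
  then show "k \<in> {j \<in> jobs G. 0 < ptime G j \<and> t \<le> weight G j / ptime G j} \<or> ptime G k = 0"
    using j k w by force
qed auto

text \<open>Its Smith ratio is 0, so all its predecessors have length 0 too. Such jobs drop out of
  the social cost.\<close>

lemma completion_zero_job:
  assumes "sched_instance G" "j \<in> jobs G" "ptime G j = 0"
  shows "completion G x j = 0"
  unfolding completion_def
proof (rule sum.neutral, safe)
  fix k assume k: "k \<in> jobs G" "precedes G k j"
  then have "0 < weight G k" "0 \<le> ptime G k" "smith_ratio G k \<le> 0"
    using assms by (auto simp: sched_instance_def precedes_def smith_ratio_def)
  then show "ptime G k = 0" by (simp add: smith_ratio_def divide_le_0_iff)
qed (use assms in simp)

text \<open>With \<open>r\<close> as density, the social cost weights the unit-density terms by
  \<open>r\<close>. The sums of the deficits \<open>a\<close> over the upper level sets of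
  \<open>r\<close> are nonpositive, because these sets are initial segments.\<close>

lemma pure_nash_social_cost_le:
  assumes G: "sched_instance G" and x: "pure_nash G x" and y: "y \<in> assignments G"
  shows "social_cost G x \<le> poa_bound * social_cost G y"
proof -
  define J where "J = {j \<in> jobs G. 0 < ptime G j}"
  define r where "r j = weight G j / ptime G j" for j
  define a where "a j = ptime G j * completion G x j - poa_bound * (ptime G j * completion G y j)" for j
  have fin: "finite (jobs G)" using G by (simp add: sched_instance_def)
  have cost: "social_cost G z = (\<Sum>j\<in>J. r j * (ptime G j * completion G z j))" for z
  proof -
    have "ptime G j = 0" if "j \<in> jobs G - J" for j
      using that G by (force simp: J_def sched_instance_def)
    then have "social_cost G z = (\<Sum>j\<in>J. weight G j * completion G z j)"
      unfolding social_cost_def using fin completion_zero_job[OF G]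
      by (intro sum.mono_neutral_right) (auto simp: J_def)
    also have "\<dots> = (\<Sum>j\<in>J. r j * (ptime G j * completion G z j))"
      by (intro sum.cong) (auto simp: J_def r_def)
    finally show ?thesis .
  qed
  have "(\<Sum>j\<in>J. r j * a j) \<le> 0"
  proof (rule weighted_sum_nonpos_if_upper_level_sums_nonpos)
    show "finite J" using fin by (simp add: J_def)
    show "0 \<le> r j" if "j \<in> J" for j
      using that G by (auto simp: J_def r_def sched_instance_def)
    fix t
    have eq: "{j \<in> J. t \<le> r j} = {j \<in> jobs G. 0 < ptime G j \<and> t \<le> weight G j / ptime G j}"
      by (auto simp: J_def r_def)
    show "sum a {j \<in> J. t \<le> r j} \<le> 0"
      using pure_nash_unit_density_bound[OF G initial_segment_density_level[OF G, of t] x y]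
      unfolding eq a_def sum_subtractf sum_distrib_left[symmetric] by simp
  qed
  also have "(\<Sum>j\<in>J. r j * a j) = social_cost G x - poa_bound * social_cost G y"
    unfolding cost a_def sum_distrib_left sum_subtractf[symmetric]
    by (intro sum.cong) (auto simp: algebra_simps)
  finally show ?thesis by simp
qed

section \<open>Attained optimum and supremum over instances\<close>

lemma finite_assignments: "sched_instance G \<Longrightarrow> finite (assignments G)"
  by (auto simp: assignments_def sched_instance_def intro: finite_PiE)

lemma opt_cost_attained:
  assumes "sched_instance G"
  obtains y where "y \<in> assignments G" "opt_cost G = social_cost G y"
proof -
  have "assignments G \<noteq> {}"
    using assms by (auto simp: assignments_def sched_instance_def PiE_eq_empty_iff)
  then have "opt_cost G \<in> social_cost G ` assignments G"
    unfolding opt_cost_def using finite_assignments[OF assms] by (intro Min_in) auto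
  with that show thesis by blast
qed

lemma social_cost_nonneg:
  assumes "sched_instance G"
  shows "0 \<le> social_cost G x"
  using assms unfolding social_cost_def completion_def
  by (intro sum_nonneg mult_nonneg_nonneg) (auto simp: sched_instance_def less_imp_le)

lemma pure_poa_le: "pure_poa TYPE('j) TYPE('m) \<le> ereal poa_bound"
  unfolding pure_poa_def
proof (intro SUP_least, safe)
  fix G :: "('j, 'm) sched_game" and x
  assume G: "sched_instance G" and x: "pure_nash G x"
  obtain y where y: "y \<in> assignments G" "opt_cost G = social_cost G y"
    using opt_cost_attained[OF G] .
  have le: "social_cost G x \<le> poa_bound * opt_cost G"
    using pure_nash_social_cost_le[OF G x y(1)] y(2) by simp
  show "ereal (social_cost G x) / ereal (opt_cost G) \<le> ereal poa_bound"
  proof (cases "opt_cost G = 0")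
    \<comment> \<open>Optimal cost 0 forces equilibrium cost 0, and this quotient is 0 in
      \<open>ereal\<close>, so no infinite ratio arises.\<close>
    case True
    with le social_cost_nonneg[OF G, of x] have "social_cost G x = 0" by simp
    then show ?thesis using True poa_bound_ge_1 by (simp add: zero_ereal_def[symmetric])
  next
    case False
    with y social_cost_nonneg[OF G, of y] have "0 < opt_cost G" by simp
    with le show ?thesis by (simp add: pos_divide_le_eq)
  qed
qed

section \<open>Reduced instances\<close>

text \<open>The filling level in the limit of vanishing \<epsilon>: \<alpha> if each large job keeps
  a machine to itself and the small work is spread over the others, otherwise the average load
  \<beta>.\<close>

definition reduced_level :: "nat \<Rightarrow> nat \<Rightarrow> real \<Rightarrow> real" where
  "reduced_level m k p =
     (if p \<ge> real m / (real m - real k) then real m / (real m - real k)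
      else (real m + p * real k) / real m)"

lemma reduced_level_nonneg: "k < m \<Longrightarrow> 0 < p \<Longrightarrow> 0 \<le> reduced_level m k p"
  by (simp add: reduced_level_def)

text \<open>Each case records the position of \<open>p\<close> relative to the level and the balance
  of work that determines the level.\<close>

lemma reduced_level_cases:
  assumes "k < m" "0 < p"
  obtains (ge) "reduced_level m k p \<le> p" "(real m - real k) * reduced_level m k p = real m"
      "reduced_opt m k p = real k * p\<^sup>2 + (real m - real k) / 2 * (reduced_level m k p)\<^sup>2"
    | (less) "p \<le> reduced_level m k p" "real m * reduced_level m k p = real m + p * real k"
      "reduced_opt m k p = (real k * p\<^sup>2 + real m * (reduced_level m k p)\<^sup>2) / 2"
proof (cases "p \<ge> real m / (real m - real k)")
  case True
  then show ?thesis
    using assms by (intro ge) (auto simp: reduced_level_def reduced_opt_def Let_def)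
next
  case False
  then have "p * (real m - real k) \<le> real m" using assms by (simp add: field_simps)
  then show ?thesis
    using assms False
    by (intro less) (auto simp: reduced_level_def reduced_opt_def Let_def field_simps)
qed

text \<open>The right-hand side is the objective of the semidefinite solution: small jobs of total
  length \<open>m\<close> contribute \<mu> per unit, and the last term is half the squared norm of
  \<open>v0\<close>. The balance of work gives the equality.\<close>

lemma reduced_opt_eq_dual:
  assumes "k < m" "0 < p"
  defines "\<mu> \<equiv> reduced_level m k p"
  shows "reduced_opt m k p
    = real m * \<mu> + real k * (dual_value \<mu> p / 2) - real m * \<mu>\<^sup>2 / 2"
  using assms(1,2)
proof (cases rule: reduced_level_cases)
  case ge
  have "real m * \<mu> = (real m - real k) * \<mu>\<^sup>2"
    using ge(2) by (simp add: \<mu>_def power2_eq_square flip: mult.assoc)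
  moreover have "dual_value \<mu> p = 2 * p\<^sup>2 + \<mu>\<^sup>2" using ge(1) by (simp add: \<mu>_def dual_value_ge)
  ultimately show ?thesis using ge(3) by (simp add: \<mu>_def[symmetric] field_simps)
next
  case less
  have "real m * \<mu>\<^sup>2 = (real m + p * real k) * \<mu>"
    using less(2) by (simp add: \<mu>_def power2_eq_square flip: mult.assoc)
  moreover have "dual_value \<mu> p = p\<^sup>2 + 2 * \<mu> * p" using less(1) by (simp add: \<mu>_def dual_value_le)
  ultimately show ?thesis using less(3) by (simp add: \<mu>_def[symmetric] field_simps)
qed

text \<open>The right-hand side is the cost of the limiting fluid schedule, in which
  \<open>k\<close> machines have load \<open>max p \<mu>\<close>, the others load \<mu>, and the
  squares of the small jobs vanish.\<close>

lemma reduced_opt_eq_primal: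
  assumes "k < m" "0 < p"
  defines "\<mu> \<equiv> reduced_level m k p"
  shows "reduced_opt m k p
    = (real k * (max p \<mu>)\<^sup>2 + (real m - real k) * \<mu>\<^sup>2 + real k * p\<^sup>2) / 2"
  using assms(1,2)
  by (cases rule: reduced_level_cases) (auto simp: \<mu>_def[symmetric] max_def field_simps)

lemma reduced_capacity:
  assumes "k < m" "0 < p"
  defines "\<mu> \<equiv> reduced_level m k p"
  shows "real k * (max p \<mu> - p) + (real m - real k) * \<mu> = real m"
  using assms(1,2)
  by (cases rule: reduced_level_cases) (auto simp: \<mu>_def[symmetric] max_def algebra_simps)

lemma reduced_instanceE:
  assumes "reduced_instance G m k p \<epsilon>"
  obtains S L where "sched_instance G" "finite (jobs G)" "finite (machines G)"
    "card (machines G) = m" "k < m" "p > 0" "\<epsilon> > 0"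
    "\<And>j. j \<in> jobs G \<Longrightarrow> weight G j = ptime G j"
    "jobs G = S \<union> L" "S \<inter> L = {}" "finite S" "finite L"
    "real (card S) * \<epsilon> = real m" "card L = k"
    "\<And>j. j \<in> S \<Longrightarrow> ptime G j = \<epsilon>" "\<And>j. j \<in> L \<Longrightarrow> ptime G j = p"
proof -
  have G: "sched_instance G" "card (machines G) = m" "k < m" "p > 0" "\<epsilon> > 0"
    "\<And>j. j \<in> jobs G \<Longrightarrow> weight G j = ptime G j"
    and "\<exists>S L. jobs G = S \<union> L \<and> S \<inter> L = {} \<and>
        real (card S) = real m / \<epsilon> \<and> card L = k \<and>
        (\<forall>j\<in>S. ptime G j = \<epsilon>) \<and> (\<forall>j\<in>L. ptime G j = p)"
    using assms by (simp_all add: reduced_instance_def)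
  then obtain S L where SL: "jobs G = S \<union> L" "S \<inter> L = {}"
    "real (card S) = real m / \<epsilon>" "card L = k"
    "\<forall>j\<in>S. ptime G j = \<epsilon>" "\<forall>j\<in>L. ptime G j = p"
    by (elim exE conjE)
  have fin: "finite (jobs G)" "finite (machines G)" using G(1) by (simp_all add: sched_instance_def)
  then have "finite S" "finite L" unfolding SL(1) by simp_all
  then show thesis using G SL fin by (intro that[of S L]) simp_all
qed

text \<open>One coordinate per machine makes vectors of different machines orthogonal; on a common
  machine the truncation \<open>q j\<close> \<le> \<open>ptime G j\<close> bounds the inner
  products.\<close>

lemma reduced_instance_sdp_solution:
  fixes G :: "('j, 'm) sched_game"
  assumes "reduced_instance G m k p \<epsilon>"
  shows "\<exists>d y v0 v. sdp_sr_feasible G d y v0 v \<and> sdp_sr_objective G y v0 = reduced_opt m k p"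
  using assms
proof (cases rule: reduced_instanceE)
  case (1 S L)
  define \<mu> where "\<mu> = reduced_level m k p"
  have mu: "0 \<le> \<mu>" using 1 by (simp add: \<mu>_def reduced_level_nonneg)
  obtain idx where idx: "bij_betw idx (machines G) {0..<m}"
    using ex_bij_betw_finite_nat[OF 1(3)] 1(4) by blast
  have idx_lt: "idx i < m" if "i \<in> machines G" for i
    using bij_betwE[OF idx] that by auto
  have idx_eq: "idx i = idx i' \<longleftrightarrow> i = i'" if "i \<in> machines G" "i' \<in> machines G" for i i'
    using idx that by (auto simp: bij_betw_def inj_on_def)
  define q where "q j = min (ptime G j) \<mu>" for j
  define v0 where "v0 = vec m (\<lambda>_. \<mu>)"
  define v where "v i j = q j \<cdot>\<^sub>v unit_vec m (idx i)" for i :: 'm and j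
  \<comment> \<open>Small jobs stay at \<mu> * \<epsilon>, below the permitted
    \<open>dual_value \<mu> \<epsilon> / 2\<close>, so that the objective equals
    \<open>reduced_opt\<close> for every \<epsilon> and not only in the limit.\<close>
  define y where "y j = (if j \<in> S then \<mu> * \<epsilon> else dual_value \<mu> p / 2)" for j
  have v_v: "v i j \<bullet> v i' j' = (if i = i' then q j * q j' else 0)"
    if "i \<in> machines G" "i' \<in> machines G" for i i' j j'
    using that by (simp add: v_def idx_lt idx_eq)
  have v0_v: "v0 \<bullet> v i j = \<mu> * q j" if "i \<in> machines G" for i j
    using idx_lt[OF that] by (simp add: v_def v0_def)
  have v0_v0: "v0 \<bullet> v0 = real m * \<mu>\<^sup>2"
    by (simp add: v0_def scalar_prod_def power2_eq_square)
  have pos: "0 < ptime G j" if "j \<in> jobs G" for j using that 1 by auto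
  have y_le: "y j \<le> dual_value \<mu> (ptime G j) / 2" if "j \<in> jobs G" for j
  proof (cases "j \<in> S")
    case True
    then show ?thesis
      using dual_value_ge_linear'[of \<mu> \<epsilon>] 1(15) by (simp add: y_def)
  qed (use that 1 in \<open>auto simp: y_def\<close>)
  have "sdp_sr_feasible G m y v0 v"
    unfolding sdp_sr_feasible_def
  proof (intro conjI ballI impI)
    fix i j assume "i \<in> machines G" "j \<in> jobs G"
    then show "y j \<le> (ptime G j)\<^sup>2 - v i j \<bullet> v i j / 2 + v0 \<bullet> v i j"
      using y_le[of j] by (simp add: v_v v0_v dual_value_def q_def power2_eq_square)
  next
    fix j j' i i' assume "j \<in> jobs G" "j' \<in> jobs G" "i \<in> machines G" "i' \<in> machines G"
    then show "v i j \<bullet> v i' j' \<le> ptime G j * ptime G j' * (if i = i' then 1 else 0)"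
      using pos[of j] pos[of j'] mu by (auto simp: v_v q_def intro!: mult_mono)
  qed (auto simp: v0_def v_def)
  moreover have "sdp_sr_objective G y v0 = reduced_opt m k p"
  proof -
    have "sum y (jobs G) = sum y S + sum y L"
      using 1 by (simp add: sum.union_disjoint)
    also have "sum y L = (\<Sum>j\<in>L. dual_value \<mu> p / 2)"
      using 1(10) by (intro sum.cong) (auto simp: y_def)
    also have "sum y S = \<mu> * (real (card S) * \<epsilon>)" by (simp add: y_def)
    finally show ?thesis
      using reduced_opt_eq_dual[OF 1(5,6)] 1(13,14)
      by (simp add: sdp_sr_objective_def v0_v0 \<mu>_def[symmetric] mult.commute)
  qed
  ultimately show ?thesis by blast
qed

section \<open>The optimal cost for vanishing \<epsilon>\<close>

lemma social_cost_unit_density: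
  assumes "sched_instance G" "\<And>j. j \<in> jobs G \<Longrightarrow> weight G j = ptime G j" "x \<in> assignments G"
  shows "social_cost G x
    = ((\<Sum>i\<in>machines G. (load (ptime G) (jobs G) x i)\<^sup>2) + (\<Sum>j\<in>jobs G. (ptime G j)\<^sup>2)) / 2"
  using sum_ptime_completion[OF assms(1) initial_segment_jobs assms(3)] assms(2)
  by (simp add: social_cost_def)

lemma reduced_opt_le_opt_cost:
  assumes "reduced_instance G m k p \<epsilon>"
  shows "reduced_opt m k p \<le> opt_cost G"
  using assms
proof (cases rule: reduced_instanceE)
  case (1 S L)
  define \<mu> where "\<mu> = reduced_level m k p"
  have mu: "0 \<le> \<mu>" using 1 by (simp add: \<mu>_def reduced_level_nonneg)
  obtain y where y: "y \<in> assignments G" "opt_cost G = social_cost G y"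
    using opt_cost_attained[OF 1(1)] .
  have "real m * (2 * \<mu>) = (\<Sum>j\<in>S. 2 * \<mu> * \<epsilon>)" using 1(13) by (simp add: algebra_simps)
  also have "\<dots> \<le> (\<Sum>j\<in>S. dual_value \<mu> (ptime G j))"
    using 1(15) dual_value_ge_linear' by (intro sum_mono) simp
  finally have "real m * (2 * \<mu>) + real k * dual_value \<mu> p - real m * \<mu>\<^sup>2
      \<le> (\<Sum>j\<in>jobs G. dual_value \<mu> (ptime G j)) - real (card (machines G)) * \<mu>\<^sup>2"
    using 1 by (simp add: sum.union_disjoint)
  also have "\<dots> \<le> (\<Sum>i\<in>machines G. (load (ptime G) (jobs G) y i)\<^sup>2) + (\<Sum>j\<in>jobs G. (ptime G j)\<^sup>2)"
    using 1 mu y by (intro sum_squares_ge_dual) (auto simp: assignments_def sched_instance_def)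
  also have "\<dots> = 2 * opt_cost G"
    using social_cost_unit_density[OF 1(1) 1(8) y(1)] y(2) by simp
  finally show ?thesis
    using reduced_opt_eq_dual[OF 1(5,6)] by (simp add: \<mu>_def[symmetric] field_simps)
qed

text \<open>While work remains, averaging yields a machine still strictly below its capacity. The
  next job goes there and overshoots by at most \<epsilon>.\<close>

lemma greedy_filling:
  fixes cap :: "'m \<Rightarrow> real"
  assumes "finite S" "finite M" "0 < \<epsilon>" "\<And>i. i \<in> M \<Longrightarrow> 0 \<le> cap i"
    and "real (card S) * \<epsilon> \<le> sum cap M"
  shows "\<exists>f. f ` S \<subseteq> M \<and> (\<forall>i\<in>M. real (card {j \<in> S. f j = i}) * \<epsilon> \<le> cap i + \<epsilon>)"
  using assms(1,5)
proof (induction S rule: finite_induct)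
  case empty
  show ?case using assms(3,4) by force
next
  case (insert s S)
  then have room: "real (card S) * \<epsilon> < sum cap M" and "real (card S) * \<epsilon> \<le> sum cap M"
    using assms(3) by (auto simp: algebra_simps)
  with insert.IH obtain f where f: "f ` S \<subseteq> M"
    "\<And>i. i \<in> M \<Longrightarrow> real (card {j \<in> S. f j = i}) * \<epsilon> \<le> cap i + \<epsilon>" by blast
  have "(\<Sum>i\<in>M. real (card {j \<in> S. f j = i}) * \<epsilon>) = real (card S) * \<epsilon>"
    using sum_over_machines[OF insert.hyps(1) assms(2) f(1), of "\<lambda>_. \<epsilon>"] by simp
  with room have "\<not> (\<forall>i\<in>M. cap i \<le> real (card {j \<in> S. f j = i}) * \<epsilon>)"
    by (metis (no_types, lifting) not_less sum_mono)
  then obtain i where i: "i \<in> M" "real (card {j \<in> S. f j = i}) * \<epsilon> < cap i" by auto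
  let ?f = "f(s := i)"
  have S_eq: "{j \<in> insert s S. ?f j = i'} = (if i' = i then insert s {j \<in> S. f j = i'} else {j \<in> S. f j = i'})"
    for i'
    using insert.hyps(2) by auto
  have "real (card {j \<in> insert s S. ?f j = i'}) * \<epsilon> \<le> cap i' + \<epsilon>" if "i' \<in> M" for i'
    unfolding S_eq using f(2)[OF that] i insert.hyps by (auto simp: algebra_simps)
  moreover have "?f ` insert s S \<subseteq> M" using f(1) i by auto
  ultimately show ?case by blast
qed

text \<open>The fluid cost with every load raised by \<epsilon>; \<open>real m * \<epsilon>\<close>
  is the sum of squares of the small jobs.\<close>

definition greedy_cost :: "nat \<Rightarrow> nat \<Rightarrow> real \<Rightarrow> real \<Rightarrow> real" where
  "greedy_cost m k p \<epsilon> =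
     (let \<mu> = reduced_level m k p in
      (real k * (max p \<mu> + \<epsilon>)\<^sup>2 + (real m - real k) * (\<mu> + \<epsilon>)\<^sup>2
        + real k * p\<^sup>2 + real m * \<epsilon>) / 2)"

lemma opt_cost_le_greedy_cost:
  fixes G :: "('j, 'm) sched_game"
  assumes "reduced_instance G m k p \<epsilon>"
  shows "opt_cost G \<le> greedy_cost m k p \<epsilon>"
  using assms
proof (cases rule: reduced_instanceE)
  case (1 S L)
  let ?M = "machines G"
  define \<mu> where "\<mu> = reduced_level m k p"
  have mu: "0 \<le> \<mu>" using 1 by (simp add: \<mu>_def reduced_level_nonneg)
  obtain H where H: "H \<subseteq> ?M" "card H = k" "finite H"
    using obtain_subset_with_card_n[of k ?M] 1(4,5) by auto
  obtain h where h: "bij_betw h L H"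
    using 1 H by (metis finite_same_card_bij)
  \<comment> \<open>The machines in \<open>H\<close> receive one large job each; \<open>cap\<close>
    is the room then left below \<open>max p \<mu>\<close>, or below \<mu> elsewhere.\<close>
  define cap where "cap i = (if i \<in> H then max p \<mu> - p else \<mu>)" for i
  have split: "(\<Sum>i\<in>?M. if i \<in> H then a else b) = real k * a + (real m - real k) * b" for a b :: real
  proof -
    have "?M \<inter> {i. i \<in> H} = H" "?M \<inter> - {i. i \<in> H} = ?M - H" using H by auto
    then show ?thesis using 1 H
      by (simp add: sum.If_cases card_Diff_subset)
  qed
  have "real (card S) * \<epsilon> \<le> sum cap ?M"
    using 1(13) reduced_capacity[OF 1(5,6)] by (simp add: cap_def split \<mu>_def[symmetric])
  moreover have "0 \<le> cap i" for i using mu by (simp add: cap_def)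
  ultimately obtain f where f: "f ` S \<subseteq> ?M"
    "\<And>i. i \<in> ?M \<Longrightarrow> real (card {j \<in> S. f j = i}) * \<epsilon> \<le> cap i + \<epsilon>"
    using greedy_filling[OF 1(11,3,7), of cap] by blast
  define x where "x = (\<lambda>j\<in>jobs G. if j \<in> S then f j else h j)"
  have x: "x \<in> assignments G"
    using f(1) bij_betwE[OF h] H(1) 1(9)
    by (auto simp: x_def assignments_def image_subset_iff subset_iff)
  have xS: "x j = f j" if "j \<in> S" for j using that 1(9) by (simp add: x_def)
  have xL: "x j = h j" if "j \<in> L" for j using that 1(9,10) by (auto simp: x_def)
  have load_le: "load (ptime G) (jobs G) x i \<le> (if i \<in> H then max p \<mu> + \<epsilon> else \<mu> + \<epsilon>)"
    if i: "i \<in> ?M" for i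
  proof -
    have "{j \<in> jobs G. x j = i} = {j \<in> S. f j = i} \<union> {j \<in> L. h j = i}"
      using 1(9) xS xL by auto
    then have "load (ptime G) (jobs G) x i
        = sum (ptime G) {j \<in> S. f j = i} + sum (ptime G) {j \<in> L. h j = i}"
      unfolding load_def using 1(10,11,12) by (auto intro!: sum.union_disjoint)
    also have "sum (ptime G) {j \<in> S. f j = i} = real (card {j \<in> S. f j = i}) * \<epsilon>"
      using 1(15) by simp
    also have "sum (ptime G) {j \<in> L. h j = i} = (if i \<in> H then p else 0)"
    proof (cases "i \<in> H")
      case True
      then obtain l where "l \<in> L" "h l = i" using h by (auto simp: bij_betw_def)
      then have "{j \<in> L. h j = i} = {l}" using h by (auto simp: bij_betw_def inj_on_def)
      with True \<open>l \<in> L\<close> show ?thesis using 1(16) by simp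
    next
      case False
      then have "{j \<in> L. h j = i} = {}" using h by (auto simp: bij_betw_def)
      with False show ?thesis by (simp only: sum.empty if_False)
    qed
    finally show ?thesis using f(2)[OF i] by (auto simp: cap_def split: if_splits)
  qed
  have "(\<Sum>i\<in>?M. (load (ptime G) (jobs G) x i)\<^sup>2)
      \<le> (\<Sum>i\<in>?M. if i \<in> H then (max p \<mu> + \<epsilon>)\<^sup>2 else (\<mu> + \<epsilon>)\<^sup>2)"
  proof (rule sum_mono)
    fix i assume i: "i \<in> ?M"
    have "0 \<le> load (ptime G) (jobs G) x i"
      unfolding load_def using 1(1) by (intro sum_nonneg) (auto simp: sched_instance_def)
    with load_le[OF i]
    show "(load (ptime G) (jobs G) x i)\<^sup>2 \<le> (if i \<in> H then (max p \<mu> + \<epsilon>)\<^sup>2 else (\<mu> + \<epsilon>)\<^sup>2)"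
      by (auto intro!: power_mono split: if_splits)
  qed
  also have "\<dots> = real k * (max p \<mu> + \<epsilon>)\<^sup>2 + (real m - real k) * (\<mu> + \<epsilon>)\<^sup>2"
    by (rule split)
  finally have loads: "(\<Sum>i\<in>?M. (load (ptime G) (jobs G) x i)\<^sup>2)
      \<le> real k * (max p \<mu> + \<epsilon>)\<^sup>2 + (real m - real k) * (\<mu> + \<epsilon>)\<^sup>2" .
  have "(\<Sum>j\<in>jobs G. (ptime G j)\<^sup>2) = real (card S) * \<epsilon> * \<epsilon> + real k * p\<^sup>2"
    using 1 by (simp add: sum.union_disjoint power2_eq_square)
  then have squares: "(\<Sum>j\<in>jobs G. (ptime G j)\<^sup>2) = real m * \<epsilon> + real k * p\<^sup>2"
    using 1(13) by simp
  have "opt_cost G \<le> social_cost G x"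
    unfolding opt_cost_def using finite_assignments[OF 1(1)] x by simp
  also have "\<dots> \<le> greedy_cost m k p \<epsilon>"
    using loads squares social_cost_unit_density[OF 1(1) 1(8) x]
    by (simp add: greedy_cost_def Let_def \<mu>_def[symmetric])
  finally show ?thesis .
qed

text \<open>The optimum is squeezed between \<open>reduced_opt\<close> and
  \<open>greedy_cost\<close>, which is continuous in \<epsilon> and agrees with
  \<open>reduced_opt\<close> at 0. Neither bound depends on \<open>G\<close>, so the threshold is
  uniform.\<close>

lemma opt_cost_reduced_limit:
  fixes p \<delta> :: real
  assumes "0 < \<delta>"
  shows "\<exists>\<epsilon>0>0. \<forall>(G :: ('j, 'm) sched_game) \<epsilon>.
    reduced_instance G m k p \<epsilon> \<and> \<epsilon> < \<epsilon>0 \<longrightarrow> \<bar>opt_cost G - reduced_opt m k p\<bar> < \<delta>"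
proof (cases "k < m \<and> 0 < p")
  case True
  have "isCont (greedy_cost m k p) 0"
    unfolding greedy_cost_def Let_def by (intro continuous_intros) simp
  moreover have "greedy_cost m k p 0 = reduced_opt m k p"
    using True by (simp add: greedy_cost_def reduced_opt_eq_primal Let_def)
  ultimately have "(greedy_cost m k p \<longlongrightarrow> reduced_opt m k p) (nhds 0)"
    by (metis isCont_def tendsto_at_iff_tendsto_nhds)
  then have "\<forall>\<^sub>F \<epsilon> in nhds 0. dist (greedy_cost m k p \<epsilon>) (reduced_opt m k p) < \<delta>"
    using assms by (rule tendstoD)
  then obtain e where e: "0 < e"
    "\<And>\<epsilon>. \<bar>\<epsilon>\<bar> < e \<Longrightarrow> \<bar>greedy_cost m k p \<epsilon> - reduced_opt m k p\<bar> < \<delta>"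
    unfolding eventually_nhds_metric by (auto simp: dist_real_def)
  show ?thesis
  proof (intro exI[of _ e] conjI allI impI)
    fix G :: "('j, 'm) sched_game" and \<epsilon>
    assume G: "reduced_instance G m k p \<epsilon> \<and> \<epsilon> < e"
    then have "\<bar>\<epsilon>\<bar> < e" by (simp add: reduced_instance_def)
    then show "\<bar>opt_cost G - reduced_opt m k p\<bar> < \<delta>"
      using G e(2)[of \<epsilon>] reduced_opt_le_opt_cost[of G m k p \<epsilon>]
        opt_cost_le_greedy_cost[of G m k p \<epsilon>] by linarith
  qed (rule e)
next
  case False
  \<comment> \<open>No reduced instance has these parameters, so any threshold serves.\<close>
  then show ?thesis by (intro exI[of _ 1]) (auto simp: reduced_instance_def)
qed

theorem theoremA1:
  shows
    "(\<forall>(G :: ('j, 'm) sched_game) m k p \<epsilon>. reduced_instance G m k p \<epsilon> \<longrightarrow>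
        (\<exists>d y v0 v. sdp_sr_feasible G d y v0 v \<and>
           sdp_sr_objective G y v0 = reduced_opt m k p)) \<and>
     (\<forall>m k p. \<forall>\<delta>>0. \<exists>\<epsilon>0>0. \<forall>(G :: ('j, 'm) sched_game) \<epsilon>.
        reduced_instance G m k p \<epsilon> \<and> \<epsilon> < \<epsilon>0 \<longrightarrow>
        \<bar>opt_cost G - reduced_opt m k p\<bar> < \<delta>) \<and>
     pure_poa TYPE('j) TYPE('m) \<le> ereal ((1 + sqrt 2) / 2)"
  using reduced_instance_sdp_solution opt_cost_reduced_limit pure_poa_le by blast

end
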